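(* Let $n$ be a non-negative integer and let $\mathbb D^{(n)}$ be the real Cayley-Dickson algebra of dimension $2^n$ with basis $\{e_A : 0\leqslant A\leqslant 2^n-1\}$. In the multiplication table of $\mathbb D^{(n)}$, expressed as $$e_Ae_B=(-1)^{\sigma(A,B)}e_{A\oplus B},\qquad 0\leqslant A,B\leqslant 2^n-1,$$ the twist function $\sigma(A,B)\in\mathbb Z_2$ has the following explicit form. Write $A=a_02^0+\dots+a_{n-1}2^{n-1}$ and $B=b_02^0+\dots+b_{n-1}2^{n-1}$ with all $a_i,b_i\in\{0,1\}$. Then, in $\mathbb Z_2$, $$\sigma(A,B)=\begin{cases} 0, & AB=0,\\ 1, & A=B\neq 0,\\ b_l+\sum_{i=l}^{n-1}\phi(a_i,b_i), & A\neq B,\ AB\neq 0,\ \deg A>\deg B,\\ 1+a_l+\sum_{i=l}^{n-1}\phi(a_i,b_i), & A\neq B,\ AB\neq 0,\ \deg A<\deg B,\\ a_l+\sum_{i=l}^{n-1}\phi(a_i,b_i), & A\neq B,\ AB\neq 0,\ \deg A=\deg B, \end{cases}$$ where $l=l(A,B)=\max\{\deg A,\deg B,\deg(A\oplus B)\}$.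
   Context: Cayley-Dickson algebras: $\mathbb D^{(0)}=\mathbb R$ with trivial conjugation $\bar a=a$. Given $\mathbb D^{(n)}$ with conjugation $a\mapsto\bar a$, the algebra $\mathbb D^{(n+1)}$ consists of the elements $a+bg_n$ with $a,b\in\mathbb D^{(n)}$ (as a real vector space $\mathbb D^{(n)}\oplus\mathbb D^{(n)}g_n$), where $g_n$ is a new imaginary unit, with multiplication $$(a+bg_n)(c+dg_n)=(ac-\bar d\,b)+(da+b\bar c)g_n$$ and conjugation $\overline{a+bg_n}=\bar a-bg_n$. In particular $\mathbb D^{(n)}$ has generators $g_0,\dots,g_{n-1}$ with $g_i^2=-1$ and $\overline{g_i}=-g_i$. Products of several factors are performed from left to right: $g_{i_0}g_{i_1}\cdots g_{i_k}:=(((g_{i_0}g_{i_1})g_{i_2})\cdots)g_{i_k}$. Basis: for an integer $A=a_02^0+\dots+a_{n-1}2^{n-1}$ with $a_i\in\{0,1\}$, set $e_A:=g_0^{a_0}g_1^{a_1}\cdots g_{n-1}^{a_{n-1}}$ (with $g_i^0=1$, so $e_0=1$). Binary addition: $A\oplus B:=(a_0+b_0)2^0+\dots+(a_{n-1}+b_{n-1})2^{n-1}$, where each coefficient $a_i+b_i$ is computed in $\mathbb Z_2$ (bitwise XOR). The product of two basis elements satisfies $e_Ae_B=\pm e_{A\oplus B}$, and $\sigma(A,B)\in\mathbb Z_2$ is the element defined by $e_Ae_B=(-1)^{\sigma(A,B)}e_{A\oplus B}$. Degree: for a positive integer $A=\sum_i a_i2^i$ with $a_i\in\{0,1\}$,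 $\deg A:=\min\{i\geqslant 0: a_i\neq 0\}$. The function $\phi:\mathbb Z_2\times\mathbb Z_2\to\mathbb Z_2$ is $\phi(a,b)=a+b+ab$, i.e. $\phi(a,b)=0$ if $a=b=0$ and $\phi(a,b)=1$ otherwise. In the formula for $\sigma$, $AB$ denotes the ordinary product of integers, and binary digits are regarded as elements of $\mathbb Z_2$. *)

theory Defs
  imports Complex_Main "HOL-Library.Z2"
begin

unbundle bit_operations_syntax

text \<open>
  An element of the \<open>n\<close>-th Cayley--Dickson algebra is a perfect binary tree of height \<open>n\<close> with
  real leaves: \<open>Dbl a b\<close> is the element \<open>a + b g\<^sub>n\<close> of the \<open>(n+1)\<close>-st algebra, where \<open>a\<close>
  and \<open>b\<close> belong to the \<open>n\<close>-th one. The sum and the product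
  of trees of different heights are unspecified.
\<close>

datatype cd = Real real | Dbl cd cd

fun CD :: "nat \<Rightarrow> cd set" where
  "CD 0 = range Real"
| "CD (Suc n) = {Dbl a b | a b. a \<in> CD n \<and> b \<in> CD n}"

instantiation cd :: "{plus, uminus, minus, scaleR}"
begin

fun plus_cd :: "cd \<Rightarrow> cd \<Rightarrow> cd" where
  "Real x + Real y = Real (x + y)"
| "Dbl a b + Dbl c d = Dbl (a + c) (b + d)"

fun uminus_cd :: "cd \<Rightarrow> cd" where
  "- Real x = Real (- x)"
| "- Dbl a b = Dbl (- a) (- b)"

definition minus_cd :: "cd \<Rightarrow> cd \<Rightarrow> cd" where
  "x - y = x + - (y :: cd)"

fun scaleR_cd :: "real \<Rightarrow> cd \<Rightarrow> cd" where
  "r *\<^sub>R Real x = Real (r * x)"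
| "r *\<^sub>R Dbl a b = Dbl (r *\<^sub>R a) (r *\<^sub>R b)"

instance ..

end

fun conj_cd :: "cd \<Rightarrow> cd" where
  "conj_cd (Real x) = Real x"
| "conj_cd (Dbl a b) = Dbl (conj_cd a) (- b)"

lemma size_uminus_cd [simp]: "size (- x) = size (x :: cd)"
  by (induction x) auto

lemma size_conj_cd [simp]: "size (conj_cd x) = size x"
  by (induction x) auto

instantiation cd :: times
begin

function (sequential) times_cd :: "cd \<Rightarrow> cd \<Rightarrow> cd" where
  "Real x * Real y = Real (x * y)"
| "Dbl a b * Dbl c d = Dbl (a * c - conj_cd d * b) (d * a + b * conj_cd c)"
  by pat_completeness auto

termination
  by (relation "measure (\<lambda>(x, y). size x + size y)") auto

instance ..

end

fun real_cd :: "nat \<Rightarrow> real \<Rightarrow> cd" where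
  "real_cd 0 r = Real r"
| "real_cd (Suc n) r = Dbl (real_cd n r) (real_cd n 0)"

text \<open>
  \<open>gen n i\<close> is the generator \<open>g\<^sub>i\<close>, for \<open>i < n\<close>, as an element of the \<open>n\<close>-th algebra.
  Each algebra is embedded into the next one by \<open>a \<mapsto> Dbl a 0\<close>, so \<open>gen\<close> depends on \<open>n\<close>.
\<close>

fun gen :: "nat \<Rightarrow> nat \<Rightarrow> cd" where
  "gen 0 i = undefined"
| "gen (Suc n) i =
     (if i = n then Dbl (real_cd n 0) (real_cd n 1) else Dbl (gen n i) (real_cd n 0))"

text \<open>Left-to-right product of the powers \<open>g\<^sub>i\<^bsup>a\<^sub>i\<^esup>\<close>, \<open>a\<^sub>i\<close> being the binary digits of \<open>A\<close>.\<close>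

definition cd_basis :: "nat \<Rightarrow> nat \<Rightarrow> cd" where
  "cd_basis n A =
     foldl (*) (real_cd n 1) (map (\<lambda>i. if bit A i then gen n i else real_cd n 1) [0..<n])"

definition digit :: "nat \<Rightarrow> nat \<Rightarrow> bit" where
  "digit A i = of_bool (bit A i)"

text \<open>\<open>(-1)\<^sup>s\<close> for an exponent \<open>s\<close> modulo 2\<close>

definition bit_sign :: "bit \<Rightarrow> real" where
  "bit_sign s = (if s = 0 then 1 else - 1)"

definition twist :: "nat \<Rightarrow> nat \<Rightarrow> nat \<Rightarrow> bit" where
  "twist n A B = (THE s. cd_basis n A * cd_basis n B = bit_sign s *\<^sub>R cd_basis n (A XOR B))"

definition deg :: "nat \<Rightarrow> nat" where
  "deg A = (LEAST i. bit A i)"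

definition phi :: "bit \<Rightarrow> bit \<Rightarrow> bit" where
  "phi a b = a + b + a * b"

definition twist_level :: "nat \<Rightarrow> nat \<Rightarrow> nat" where
  "twist_level A B = Max {deg A, deg B, deg (A XOR B)}"

text \<open>
  Sanity checks: the carrier is closed, \<open>Dbl a b\<close> is indeed \<open>a + b g\<^sub>n\<close>, and the elements
  \<open>cd_basis (n+1) A\<close> are those of \<open>cd_basis n\<close> placed in the first or in the second half.
\<close>

lemma real_cd_in_CD: "real_cd n r \<in> CD n"
  by (induction n arbitrary: r) auto

lemma add_in_CD: "x \<in> CD n \<Longrightarrow> y \<in> CD n \<Longrightarrow> x + y \<in> CD n"
  by (induction n arbitrary: x y) auto

lemma uminus_in_CD: "x \<in> CD n \<Longrightarrow> - x \<in> CD n"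
  by (induction n arbitrary: x) auto

lemma scaleR_in_CD: "x \<in> CD n \<Longrightarrow> r *\<^sub>R x \<in> CD n"
  by (induction n arbitrary: x) auto

lemma conj_in_CD: "x \<in> CD n \<Longrightarrow> conj_cd x \<in> CD n"
  by (induction n arbitrary: x) (auto simp: uminus_in_CD)

lemma mult_in_CD: "x \<in> CD n \<Longrightarrow> y \<in> CD n \<Longrightarrow> x * y \<in> CD n"
  by (induction n arbitrary: x y)
    (auto simp: minus_cd_def add_in_CD uminus_in_CD conj_in_CD)

lemma gen_in_CD: "i < n \<Longrightarrow> gen n i \<in> CD n"
  by (induction n) (auto simp: real_cd_in_CD less_Suc_eq)

lemma foldl_in_CD: "x \<in> CD n \<Longrightarrow> set ys \<subseteq> CD n \<Longrightarrow> foldl (*) x ys \<in> CD n"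
  by (induction ys arbitrary: x) (auto simp: mult_in_CD)

lemma cd_basis_in_CD: "cd_basis n A \<in> CD n"
  unfolding cd_basis_def by (rule foldl_in_CD) (auto simp: real_cd_in_CD gen_in_CD)

lemma uminus_zero_cd: "- real_cd n 0 = real_cd n 0"
  by (induction n) auto

lemma conj_real_cd: "conj_cd (real_cd n r) = real_cd n r"
  by (induction n arbitrary: r) (auto simp: uminus_zero_cd)

lemma add_zero_cd:
  assumes "x \<in> CD n"
  shows "x + real_cd n 0 = x" "real_cd n 0 + x = x"
  using assms by (induction n arbitrary: x) auto

lemma mult_zero_cd:
  assumes "x \<in> CD n"
  shows "x * real_cd n 0 = real_cd n 0" "real_cd n 0 * x = real_cd n 0"
  using assms
  by (induction n arbitrary: x)
    (auto simp: minus_cd_def conj_real_cd conj_in_CD uminus_zero_cd add_zero_cd real_cd_in_CD)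

lemma mult_one_cd:
  assumes "x \<in> CD n"
  shows "x * real_cd n 1 = x" "real_cd n 1 * x = x"
  using assms
  by (induction n arbitrary: x)
    (auto simp: minus_cd_def conj_real_cd conj_in_CD uminus_zero_cd add_zero_cd mult_zero_cd
      real_cd_in_CD)

lemma Dbl_eq:
  assumes "a \<in> CD n" "b \<in> CD n"
  shows "Dbl a (real_cd n 0) + Dbl b (real_cd n 0) * gen (Suc n) n = Dbl a b"
  using assms
  by (simp add: minus_cd_def conj_real_cd uminus_zero_cd add_zero_cd mult_zero_cd mult_one_cd
      real_cd_in_CD)

lemma foldl_Dbl:
  assumes "x \<in> CD n" "set ys \<subseteq> CD n"
  shows "foldl (*) (Dbl x (real_cd n 0)) (map (\<lambda>y. Dbl y (real_cd n 0)) ys) =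
    Dbl (foldl (*) x ys) (real_cd n 0)"
  using assms
  by (induction ys arbitrary: x)
    (auto simp: minus_cd_def conj_real_cd uminus_zero_cd add_zero_cd mult_zero_cd mult_in_CD
      conj_in_CD real_cd_in_CD)

lemma cd_basis_Suc:
  "cd_basis (Suc n) A =
    (if bit A n then Dbl (real_cd n 0) (cd_basis n A) else Dbl (cd_basis n A) (real_cd n 0))"
proof -
  let ?f = "\<lambda>i. if bit A i then gen n i else real_cd n 1"
  have *: "map (\<lambda>i. if bit A i then gen (Suc n) i else real_cd (Suc n) 1) [0..<n] =
      map (\<lambda>y. Dbl y (real_cd n 0)) (map ?f [0..<n])"
    by auto
  have "set (map ?f [0..<n]) \<subseteq> CD n"
    by (auto simp: real_cd_in_CD gen_in_CD)
  then have "foldl (*) (real_cd (Suc n) 1)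
        (map (\<lambda>i. if bit A i then gen (Suc n) i else real_cd (Suc n) 1) [0..<n]) =
      Dbl (cd_basis n A) (real_cd n 0)"
    apply (subst *)
    apply (simp only: real_cd.simps(2) cd_basis_def)
    apply (erule foldl_Dbl[OF real_cd_in_CD])
    done
  then show ?thesis
    using cd_basis_in_CD[of n A]
    by (simp add: cd_basis_def[of "Suc n"] minus_cd_def conj_real_cd uminus_zero_cd add_zero_cd
        mult_zero_cd mult_one_cd real_cd_in_CD del: upt_Suc_append)
qed

end

theory Submission
  imports Defs
begin

text \<open>
  Splitting off the top digits of \<open>A = A' + a 2\<^sup>n\<close> and \<open>B = B' + b 2\<^sup>n\<close>, the doubling formula
  expresses \<open>\<sigma>(A, B)\<close> at level \<open>n + 1\<close> through \<open>\<sigma>(A', B')\<close> or \<open>\<sigma>(B', A')\<close> at level \<open>n\<close>, up to the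
  sign of the conjugate of \<open>e\<^sub>B\<^sub>'\<close>. The explicit formula satisfies the same recursion because it is
  antisymmetric: exchanging two distinct positive arguments changes it by 1. When the degrees are
  equal this holds because \<open>l = deg (A \<oplus> B)\<close>, so that the digits \<open>a\<^sub>l\<close> and \<open>b\<^sub>l\<close> differ.
\<close>

subsection \<open>Scalars in the Cayley--Dickson algebras\<close>

lemma scaleR_add_cd:
  assumes "x \<in> CD n" "y \<in> CD n"
  shows "r *\<^sub>R (x + y) = r *\<^sub>R x + r *\<^sub>R (y :: cd)"
  using assms by (induction n arbitrary: x y) (auto simp: algebra_simps)

lemma uminus_cd_eq_scaleR: "- x = (- 1) *\<^sub>R (x :: cd)"
  by (induction x) auto

lemma scaleR_scaleR_cd: "r *\<^sub>R (s *\<^sub>R x) = (r * s) *\<^sub>R (x :: cd)"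
  by (induction x) auto

lemma scaleR_zero_cd: "r *\<^sub>R real_cd n 0 = real_cd n 0"
  by (induction n) auto

lemma conj_scaleR_cd: "conj_cd (r *\<^sub>R x) = r *\<^sub>R conj_cd x"
  by (induction x) (auto simp: uminus_cd_eq_scaleR scaleR_scaleR_cd)

lemma mult_scaleR_cd:
  assumes "x \<in> CD n" "y \<in> CD n"
  shows "(r *\<^sub>R x) * y = r *\<^sub>R (x * y)" "x * (r *\<^sub>R y) = r *\<^sub>R (x * y)"
proof -
  \<comment> \<open>Both claims go through one induction, because the doubling product reverses some
    factors and so turns scaling on one side into scaling on the other.\<close>
  have "(r *\<^sub>R x) * y = r *\<^sub>R (x * y) \<and> x * (r *\<^sub>R y) = r *\<^sub>R (x * y)"
    using assms
  proof (induction n arbitrary: x y)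
    case 0
    then show ?case by auto
  next
    case (Suc n)
    then show ?case
      by (auto simp: minus_cd_def uminus_cd_eq_scaleR scaleR_scaleR_cd conj_scaleR_cd
          scaleR_add_cd[of _ n] mult_in_CD conj_in_CD scaleR_in_CD)
  qed
  then show "(r *\<^sub>R x) * y = r *\<^sub>R (x * y)" "x * (r *\<^sub>R y) = r *\<^sub>R (x * y)"
    by simp_all
qed

lemma bit_sign_add: "bit_sign (s + t) = bit_sign s * bit_sign t"
  by (cases s; cases t) (auto simp: bit_sign_def)

lemma bit_sign_scaleR_add:
  "bit_sign s *\<^sub>R (bit_sign t *\<^sub>R x) = bit_sign (s + t) *\<^sub>R (x :: cd)"
  by (simp only: scaleR_scaleR_cd bit_sign_add)

lemma uminus_cd_eq_bit_sign: "- x = bit_sign 1 *\<^sub>R (x :: cd)"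
  by (simp add: bit_sign_def uminus_cd_eq_scaleR)

subsection \<open>Binary expansions\<close>

text \<open>Keeps \<open>set_bit n 0\<close> in this form, so that the rules for
  \<open>set_bit\<close> also cover numbers whose only digit is the top one.\<close>

declare set_bit_of_0 [simp del]

lemma not_bit_of_less: "\<not> bit A m" if "A < 2 ^ n" "n \<le> m" for A :: nat
  using that by (metis bit_take_bit_iff linorder_not_less take_bit_nat_eq_self)

text \<open>The top-digit split behind both inductions over the basis. Writing
  \<open>set_bit n A'\<close> rather than a sum lets digits be compared bit by bit.\<close>

lemma less_Suc_power_cases:
  fixes A :: nat
  assumes "A < 2 ^ Suc n"
  obtains "A < 2 ^ n" | A' where "A' < 2 ^ n" "A = set_bit n A'"
proof (cases "bit A n")
  case True
  have "A = set_bit n (take_bit n A)"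
    using True not_bit_of_less[OF assms]
    by (intro bit_eqI) (auto simp: bit_set_bit_iff bit_take_bit_iff,
        metis not_less_eq_eq order.strict_iff_order not_less)
  then show ?thesis
    using that(2)[of "take_bit n A"] by simp
next
  case False
  have "take_bit n A = A"
    using False not_bit_of_less[OF assms]
    by (intro bit_eqI) (auto simp: bit_take_bit_iff intro: ccontr, metis Suc_leI linorder_neqE_nat)
  then show ?thesis
    using that(1) by (metis take_bit_nat_less_exp)
qed

lemma xor_less_power: "A XOR B < 2 ^ n" if "A < 2 ^ n" "B < 2 ^ n" for A B :: nat
  using that by (metis take_bit_nat_eq_self take_bit_nat_less_exp take_bit_xor)

lemma set_bit_neq_zero: "set_bit n A \<noteq> 0" for A :: nat
  by (metis bit_0_eq bit_set_bit_iff bot_apply bot_bool_def possible_bit_nat)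

lemma set_bit_xor_set_bit:
  "set_bit n A XOR set_bit n B = A XOR B" if "A < 2 ^ n" "B < 2 ^ n" for A B :: nat
  using that[THEN not_bit_of_less, OF order_refl]
  by (intro bit_eqI) (auto simp: bit_set_bit_iff bit_xor_iff)

lemma set_bit_xor:
  "set_bit n A XOR B = set_bit n (A XOR B)" "A XOR set_bit n B = set_bit n (A XOR B)"
  if "A < 2 ^ n" "B < 2 ^ n" for A B :: nat
  using that[THEN not_bit_of_less, OF order_refl]
  by (auto intro!: bit_eqI simp: bit_set_bit_iff bit_xor_iff)

lemma set_bit_inject:
  "set_bit n A = set_bit n B \<longleftrightarrow> A = B" if "A < 2 ^ n" "B < 2 ^ n" for A B :: nat
  using set_bit_xor_set_bit[OF that] by (metis xor.assoc xor.right_neutral xor_self_eq)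

lemma xor_eq_zero_iff: "A XOR B = 0 \<longleftrightarrow> A = B" for A B :: nat
  by (metis xor.assoc xor.right_neutral xor_self_eq xor.commute)

lemma set_bit_neq: "A \<noteq> set_bit n B" "set_bit n B \<noteq> A" if "A < 2 ^ n" for A B :: nat
  using not_bit_of_less[OF that order_refl] by (auto simp: bit_set_bit_iff)

lemma bit_deg: "bit A (deg A)" if "A \<noteq> 0"
  unfolding deg_def using that by (metis LeastI_ex bit_eqI bit_0_eq bot_apply bot_bool_def)

lemma not_bit_less_deg: "\<not> bit A i" if "i < deg A"
  using that unfolding deg_def by (rule not_less_Least)

lemma deg_eqI: "deg A = i" if "bit A i" "\<And>j. j < i \<Longrightarrow> \<not> bit A j"
  unfolding deg_def using that by (intro Least_equality) (auto simp: not_less[symmetric])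

lemma deg_less: "deg A < n" if "A < 2 ^ n" "A \<noteq> 0"
  using bit_deg[OF that(2)] not_bit_of_less[OF that(1)] by (meson not_less)

lemma deg_set_bit: "deg (set_bit n A) = (if A = 0 then n else deg A)" if "A < 2 ^ n"
  using bit_deg[of A] not_bit_less_deg[of _ A] deg_less[OF that]
  by (intro deg_eqI) (auto simp: bit_set_bit_iff split: if_splits)

lemma digit_set_bit: "digit (set_bit n A) i = (if i = n then 1 else digit A i)"
  by (auto simp: digit_def bit_set_bit_iff)

lemma digit_eq_zero: "digit A m = 0" if "A < 2 ^ n" "n \<le> m"
  using not_bit_of_less[OF that] by (simp add: digit_def)

subsection \<open>The explicit twist\<close>

text \<open>Separated from \<open>twist\<close> so that its recursion can be proved by pure digit
  arithmetic; \<open>n\<close> enters only as the end of the sum.\<close>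

definition twist_formula :: "nat \<Rightarrow> nat \<Rightarrow> nat \<Rightarrow> bit" where
  "twist_formula n A B =
    (let l = twist_level A B in
     if A * B = 0 then 0
     else if A = B then 1
     else if deg A > deg B then digit B l + (\<Sum>i = l..<n. phi (digit A i) (digit B i))
     else if deg A < deg B then 1 + digit A l + (\<Sum>i = l..<n. phi (digit A i) (digit B i))
     else digit A l + (\<Sum>i = l..<n. phi (digit A i) (digit B i)))"

lemma phi_commute: "phi a b = phi b a"
  by (simp only: phi_def ac_simps)

lemma twist_level_commute: "twist_level A B = twist_level B A"
  by (simp add: twist_level_def insert_commute xor.commute)

lemma twist_level_less:
  "twist_level A B < n" if "A < 2 ^ n" "B < 2 ^ n" "A \<noteq> 0" "B \<noteq> 0" "A \<noteq> B"
  using that by (simp add: twist_level_def deg_less xor_less_power xor_eq_zero_iff)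

lemma digit_twist_level_neq:
  assumes "A \<noteq> 0" "B \<noteq> 0" "A \<noteq> B" "deg A = deg B"
  shows "digit A (twist_level A B) = 1 + digit B (twist_level A B)"
proof -
  have xor: "bit (A XOR B) (deg (A XOR B))"
    using assms by (intro bit_deg) (simp add: xor_eq_zero_iff)
  \<comment> \<open>Below their common degree both numbers have only zero digits, so they cannot
    differ there.\<close>
  have "deg A \<le> deg (A XOR B)"
    using xor not_bit_less_deg[of _ A] not_bit_less_deg[of _ B] assms(4)
    by (metis bit_xor_iff not_less)
  then have "twist_level A B = deg (A XOR B)"
    using assms(4) by (simp add: twist_level_def)
  then show ?thesis
    using xor by (auto simp: bit_xor_iff digit_def)
qed

text \<open>For unequal degrees the swap exchanges two branches that read the same digit and differ
  by the constant 1. For equal degrees the branch stays and reads the other, opposite digit.\<close>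

lemma twist_formula_commute:
  "twist_formula n A B = (if A = B \<or> A = 0 \<or> B = 0 then 0 else 1) + twist_formula n B A"
  using digit_twist_level_neq[of A B]
  by (auto simp: twist_formula_def Let_def twist_level_commute[of B A] phi_commute[of "digit B _"]
      add.assoc)

lemma twist_formula_Suc:
  assumes "A < 2 ^ n" "B < 2 ^ n"
  shows "twist_formula (Suc n) A B = twist_formula n A B"
  using assms twist_level_less[OF assms]
  by (auto simp: twist_formula_def Let_def digit_eq_zero phi_def)

text \<open>A new top digit alters the degree only of zero, and that degree becomes
  \<open>n\<close>, above the others. The XOR gains the digit exactly when one argument alone
  does.\<close>

lemma twist_level_set_bit:
  assumes "A < 2 ^ n" "B < 2 ^ n"
  shows "A \<noteq> 0 \<Longrightarrow>
      twist_level A (set_bit n B) = (if B = 0 \<or> A = B then n else twist_level A B)"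
    and "B \<noteq> 0 \<Longrightarrow>
      twist_level (set_bit n A) B = (if A = 0 \<or> A = B then n else twist_level A B)"
    and "A \<noteq> B \<Longrightarrow>
      twist_level (set_bit n A) (set_bit n B) = (if A = 0 \<or> B = 0 then n else twist_level A B)"
  using assms deg_less[of A n] deg_less[of B n]
  by (auto simp: twist_level_def set_bit_xor set_bit_xor_set_bit deg_set_bit xor_less_power
      xor_eq_zero_iff max_def)

text \<open>The generic case: branch, selected digit and lower limit all persist, so the sum only
  gains its term at \<open>n\<close>.\<close>

lemma twist_formula_Suc_eq:
  assumes "A \<noteq> 0" "B \<noteq> 0" "A \<noteq> B" "A' \<noteq> 0" "B' \<noteq> 0" "A' \<noteq> B'"
    and "deg A' = deg A" "deg B' = deg B" "twist_level A' B' = twist_level A B"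
    and "twist_level A B < n"
    and "\<And>i. i < n \<Longrightarrow> digit A' i = digit A i" "\<And>i. i < n \<Longrightarrow> digit B' i = digit B i"
  shows "twist_formula (Suc n) A' B' = twist_formula n A B + phi (digit A' n) (digit B' n)"
  using assms
  by (simp add: twist_formula_def Let_def add.assoc del: add_bit_eq_xor mult_bit_eq_and)

text \<open>Matches \<open>a (d g) = (d a) g\<close>. Generically the new term
  \<open>phi 0 1 = 1\<close> cancels the 1 from exchanging the arguments.\<close>

lemma twist_formula_set_bit_right:
  assumes "A < 2 ^ n" "B < 2 ^ n"
  shows "twist_formula (Suc n) A (set_bit n B) = twist_formula n B A"
\<comment> \<open>In the degenerate cases either the integer product vanishes or the level becomes
  \<open>n\<close>, leaving a single summand.\<close>
proof (cases "A = 0 \<or> B = 0 \<or> A = B")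
  case True
  then consider "A = 0" | "A \<noteq> 0" "B = 0" | "A \<noteq> 0" "B \<noteq> 0" "A = B"
    by blast
  then show ?thesis
    by cases (use assms deg_less in \<open>simp_all add: twist_formula_def Let_def
      twist_level_set_bit set_bit_neq deg_set_bit digit_set_bit digit_eq_zero phi_def
      set_bit_neq_zero less_not_sym\<close>)
next
  case False
  then have "twist_formula (Suc n) A (set_bit n B) = twist_formula n A B + phi 0 1"
    using assms twist_level_less[OF assms]
    by (subst twist_formula_Suc_eq[of A B])
      (auto simp: twist_level_set_bit set_bit_neq deg_set_bit digit_set_bit digit_eq_zero
        set_bit_neq_zero)
  then show ?thesis
    using False by (simp add: twist_formula_commute[of n A B] phi_def)
qed

text \<open>Matches \<open>(b g) c = (b (conj c)) g\<close>; \<open>of_bool (B \<noteq> 0)\<close>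
  is the sign of the conjugate, generically equal to \<open>phi 1 0\<close>.\<close>

lemma twist_formula_set_bit_left:
  assumes "A < 2 ^ n" "B < 2 ^ n"
  shows "twist_formula (Suc n) (set_bit n A) B = of_bool (B \<noteq> 0) + twist_formula n A B"
proof (cases "A = 0 \<or> B = 0 \<or> A = B")
  case True
  then consider "A = 0" | "A \<noteq> 0" "B = 0" | "A \<noteq> 0" "B \<noteq> 0" "A = B"
    by blast
  then show ?thesis
    by cases (use assms deg_less in \<open>simp_all add: twist_formula_def Let_def
      twist_level_set_bit set_bit_neq deg_set_bit digit_set_bit digit_eq_zero phi_def
      set_bit_neq_zero less_not_sym\<close>)
next
  case False
  then have "twist_formula (Suc n) (set_bit n A) B = twist_formula n A B + phi 1 0"
    using assms twist_level_less[OF assms]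
    by (subst twist_formula_Suc_eq[of A B])
      (auto simp: twist_level_set_bit set_bit_neq deg_set_bit digit_set_bit digit_eq_zero
        set_bit_neq_zero)
  then show ?thesis
    using False by (simp add: phi_def)
qed

text \<open>Matches \<open>(b g) (d g) = - (conj d) b\<close>: the 1 is the minus sign and
  \<open>of_bool (B \<noteq> 0)\<close> comes from the conjugate.\<close>

lemma twist_formula_set_bit_both:
  assumes "A < 2 ^ n" "B < 2 ^ n"
  shows "twist_formula (Suc n) (set_bit n A) (set_bit n B) =
    1 + of_bool (B \<noteq> 0) + twist_formula n B A"
proof (cases "A = 0 \<or> B = 0 \<or> A = B")
  case True
  then consider "A = 0" | "A \<noteq> 0" "B = 0" | "A \<noteq> 0" "B \<noteq> 0" "A = B"
    by blast
  then show ?thesis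
    by cases (use assms deg_less in \<open>simp_all add: twist_formula_def Let_def
      twist_level_set_bit set_bit_inject deg_set_bit digit_set_bit phi_def set_bit_neq_zero
      less_not_sym\<close>)
next
  case False
  then have "twist_formula (Suc n) (set_bit n A) (set_bit n B) = twist_formula n A B + phi 1 1"
    using assms twist_level_less[OF assms]
    by (subst twist_formula_Suc_eq[of A B])
      (auto simp: twist_level_set_bit set_bit_inject deg_set_bit digit_set_bit set_bit_neq_zero)
  then show ?thesis
    using False by (simp add: twist_formula_commute[of n A B] phi_def)
qed

subsection \<open>The multiplication table\<close>

lemma cd_basis_set_bit: "cd_basis n (set_bit n A) = cd_basis n A"
  unfolding cd_basis_def
  by (intro arg_cong[where f = "foldl _ _"] map_cong) (auto simp: bit_set_bit_iff)

lemma cd_basis_Suc_less: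
  "cd_basis (Suc n) A = Dbl (cd_basis n A) (real_cd n 0)" if "A < 2 ^ n"
  using not_bit_of_less[OF that order_refl] by (simp add: cd_basis_Suc)

lemma cd_basis_Suc_set_bit:
  "cd_basis (Suc n) (set_bit n A) = Dbl (real_cd n 0) (cd_basis n A)"
  by (simp add: cd_basis_Suc bit_set_bit_iff cd_basis_set_bit)

lemma conj_cd_basis: "conj_cd (cd_basis n A) = bit_sign (of_bool (A \<noteq> 0)) *\<^sub>R cd_basis n A"
  if "A < 2 ^ n"
  using that
proof (induction n arbitrary: A)
  case 0
  then show ?case by (simp add: cd_basis_def bit_sign_def)
next
  case (Suc n)
  from Suc.prems show ?case
  proof (cases rule: less_Suc_power_cases)
    case 1
    then show ?thesis
      by (simp add: cd_basis_Suc_less Suc.IH uminus_zero_cd scaleR_zero_cd)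
  next
    case (2 A')
    then show ?thesis
      by (simp add: cd_basis_Suc_set_bit conj_real_cd scaleR_zero_cd set_bit_neq_zero
          uminus_cd_eq_bit_sign)
  qed
qed

lemma cd_basis_mult:
  assumes "A < 2 ^ n" "B < 2 ^ n"
  shows "cd_basis n A * cd_basis n B = bit_sign (twist_formula n A B) *\<^sub>R cd_basis n (A XOR B)"
  using assms
proof (induction n arbitrary: A B)
  case 0
  then show ?case by (simp add: cd_basis_def bit_sign_def twist_formula_def)
next
  case (Suc n)
  \<comment> \<open>Each doubled basis element has one zero half, so a single term of the product
    survives in each of the four cases. The induction hypothesis may meet it with the factors
    reversed, and \<open>xor.commute\<close> realigns the index.\<close>
  note simps = cd_basis_Suc_less cd_basis_Suc_set_bit set_bit_xor set_bit_xor_set_bit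
    xor_less_power minus_cd_def conj_real_cd uminus_zero_cd scaleR_zero_cd add_zero_cd mult_zero_cd
    cd_basis_in_CD real_cd_in_CD conj_in_CD scaleR_in_CD mult_in_CD conj_cd_basis
    mult_scaleR_cd[OF cd_basis_in_CD cd_basis_in_CD] Suc.IH bit_sign_scaleR_add
    uminus_cd_eq_bit_sign xor.commute
    twist_formula_Suc twist_formula_set_bit_left twist_formula_set_bit_right
    twist_formula_set_bit_both
  from Suc.prems(1) show ?case
  proof (cases rule: less_Suc_power_cases)
    case A: 1
    from Suc.prems(2) show ?thesis
      by (cases rule: less_Suc_power_cases) (simp_all add: A simps)
  next
    case A: (2 A')
    from Suc.prems(2) show ?thesis
      by (cases rule: less_Suc_power_cases) (simp_all add: A simps add.assoc del: add_bit_eq_xor)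
  qed
qed

lemma scaleR_cd_basis_inject: "r *\<^sub>R cd_basis n A = s *\<^sub>R cd_basis n A \<longleftrightarrow> r = s"
  by (induction n) (auto simp: cd_basis_Suc, simp_all add: cd_basis_def)

theorem theorem1:
  fixes n A B :: nat
  assumes "A < 2 ^ n" and "B < 2 ^ n"
  shows "cd_basis n A * cd_basis n B = bit_sign (twist n A B) *\<^sub>R cd_basis n (A XOR B) \<and>
    twist n A B =
      (let l = twist_level A B in
       if A * B = 0 then 0
       else if A = B then 1
       else if deg A > deg B then digit B l + (\<Sum>i = l..<n. phi (digit A i) (digit B i))
       else if deg A < deg B then 1 + digit A l + (\<Sum>i = l..<n. phi (digit A i) (digit B i))
       else digit A l + (\<Sum>i = l..<n. phi (digit A i) (digit B i)))"
proof -
  note mult = cd_basis_mult[OF assms]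
  \<comment> \<open>Injectivity of the sign, together with that of scaling a basis element, makes
    the exponent selected by \<open>THE\<close> unique.\<close>
  have "s = t" if "bit_sign s = bit_sign t" for s t
    using that by (cases s; cases t) (auto simp: bit_sign_def)
  then have "twist n A B = twist_formula n A B"
    unfolding twist_def by (intro the_equality) (auto simp: mult scaleR_cd_basis_inject)
  then show ?thesis
    using mult by (simp only: twist_formula_def)
qed

end
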